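(* Let $q\ge 6$ be a prime power and let $\mathcal V$ be a ruled quintic surface in $\mathrm{PG}(6,q)$ with conic directrix $\mathcal C$. (1) Any two distinct twisted cubics contained in $\mathcal V$ meet in exactly one point. (2) If $P,Q$ are points of $\mathcal V$ lying on different generators of $\mathcal V$ and not on $\mathcal C$, then there is a unique twisted cubic contained in $\mathcal V$ containing both $P$ and $Q$.
   Context: Construction: in $\mathrm{PG}(6,q)$ let $\alpha$ be a plane and $\Pi_3$ a $3$-space with $\alpha\cap\Pi_3=\emptyset$. Let $\mathcal C$ be a non-degenerate conic in $\alpha$ and $\mathcal N_3$ a twisted cubic in $\Pi_3$, parametrised as $\mathcal C=\{(1,\theta,\theta^2)\}$ and $\mathcal N_3=\{(1,\epsilon,\epsilon^2,\epsilon^3)\}$ ($\theta,\epsilon\in\mathbb F_q\cup\{\infty\}$), and let $\phi\in\mathrm{PGL}(2,q)$ act on parameters, giving a bijection $\mathcal C\to\mathcal N_3$. The ruled quintic surface $\mathcal V$ is the set of points on the $q+1$ lines (generators) joining each point of $\mathcal C$ to its image under $\phi$; $\mathcal C$ is its conic directrix. *)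

theory Defs
  imports "HOL-Analysis.Analysis"
begin

text \<open>Projective geometry over a field: a subspace of projective dimension \<open>k\<close> is a linear
  subspace of dimension \<open>k + 1\<close> of the coordinate space, and the points are the linear
  subspaces of dimension 1.  With \<open>'n = 7\<close> and a finite field of \<open>q\<close> elements this
  is \<open>PG(6,q)\<close>.\<close>

definition pg_subspace :: "nat \<Rightarrow> ('a::field ^ 'n) set \<Rightarrow> bool" where
  "pg_subspace k U \<longleftrightarrow> vec.subspace U \<and> vec.dim U = k + 1"

definition pg_points :: "('a::field ^ 'n) set \<Rightarrow> ('a ^ 'n) set set" where
  "pg_points U = {P. pg_subspace 0 P \<and> P \<subseteq> U}"

definition pg_join :: "('a::field ^ 'n) set \<Rightarrow> ('a ^ 'n) set \<Rightarrow> ('a ^ 'n) set" where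
  "pg_join P Q = vec.span (P \<union> Q)"

definition pg_frame :: "nat \<Rightarrow> ('a::field ^ 'n) set \<Rightarrow> (nat \<Rightarrow> 'a ^ 'n) \<Rightarrow> bool" where
  "pg_frame k U b \<longleftrightarrow>
     inj_on b {..k} \<and> vec.independent (b ` {..k}) \<and> vec.span (b ` {..k}) = U"

text \<open>A parameter in \<open>F\<^sub>q \<union> {\<infinity>}\<close> is an element of type \<open>'a option\<close>, where \<open>None\<close> is
  \<open>\<infinity>\<close>.  In the coordinates given by the frame \<open>b\<close>, \<open>nrc_point k b\<close> sends \<open>\<theta>\<close> to
  \<open>(1, \<theta>, \<dots>, \<theta>^k)\<close> and \<open>\<infinity>\<close> to \<open>(0, \<dots>, 0, 1)\<close>.\<close>

definition nrc_point :: "nat \<Rightarrow> (nat \<Rightarrow> 'a::field ^ 'n) \<Rightarrow> 'a option \<Rightarrow> ('a ^ 'n) set" where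
  "nrc_point k b \<theta> =
     (case \<theta> of None \<Rightarrow> vec.span {b k}
              | Some t \<Rightarrow> vec.span {\<Sum>i\<le>k. t ^ i *s b i})"

definition normal_rational_curve ::
    "nat \<Rightarrow> ('a::field ^ 'n) set \<Rightarrow> ('a ^ 'n) set set \<Rightarrow> bool" where
  "normal_rational_curve k U N \<longleftrightarrow>
     pg_subspace k U \<and> (\<exists>b. pg_frame k U b \<and> N = range (nrc_point k b))"

definition twisted_cubic :: "('a::field ^ 'n) set set \<Rightarrow> bool" where
  "twisted_cubic N \<longleftrightarrow> (\<exists>U. normal_rational_curve 3 U N)"

definition moebius :: "'a::field \<Rightarrow> 'a \<Rightarrow> 'a \<Rightarrow> 'a \<Rightarrow> 'a option \<Rightarrow> 'a option" where
  "moebius a b c d \<theta> =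
     (case \<theta> of
        None \<Rightarrow> if c = 0 then None else Some (a / c)
      | Some t \<Rightarrow> if c * t + d = 0 then None else Some ((a * t + b) / (c * t + d)))"

definition PGL2 :: "('a::field option \<Rightarrow> 'a option) set" where
  "PGL2 = {moebius a b c d | a b c d. a * d - b * c \<noteq> 0}"

text \<open>\<open>V\<close> is the point set of the surface, \<open>C\<close> its conic directrix, and \<open>G\<close> the set
  of its generators (each a line, as a linear subspace of dimension 2).  The frames \<open>b\<close> and
  \<open>c\<close> are the coordinates in which the non-degenerate conic \<open>C\<close> and the twisted cubic have the
  forms \<open>(1, \<theta>, \<theta>\<^sup>2)\<close> and \<open>(1, \<epsilon>, \<epsilon>\<^sup>2, \<epsilon>\<^sup>3)\<close>.\<close>

definition ruled_quintic_surface ::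
    "('a::field ^ 7) set set \<Rightarrow> ('a ^ 7) set set \<Rightarrow> ('a ^ 7) set set \<Rightarrow> bool" where
  "ruled_quintic_surface V C G \<longleftrightarrow>
     (\<exists>\<alpha> \<Sigma> b c \<phi>.
        pg_subspace 2 \<alpha> \<and> pg_subspace 3 \<Sigma> \<and> pg_points \<alpha> \<inter> pg_points \<Sigma> = {} \<and>
        pg_frame 2 \<alpha> b \<and> pg_frame 3 \<Sigma> c \<and> \<phi> \<in> PGL2 \<and>
        C = range (nrc_point 2 b) \<and>
        G = range (\<lambda>\<theta>. pg_join (nrc_point 2 b \<theta>) (nrc_point 3 c (\<phi> \<theta>))) \<and>
        V = (\<Union>g\<in>G. pg_points g))"

end

theory Submission
  imports Defs
begin

text \<open>Reparametrising the cubic, we may take \<open>\<phi>\<close> to be the identity. Write \<open>u(\<theta>)\<close> and \<open>w(\<theta>)\<close> for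
  the corresponding points of the conic and of the cubic, so that the points of the surface off the conic
  are \<open>x u(\<theta>) + w(\<theta>)\<close>. Let a twisted cubic \<open>N\<close> on the surface span the solid \<open>U\<close>.
  Up to three points of the conic and up to four points \<open>x u(\<theta>) + w(\<theta>)\<close> on different generators
  are independent; counting the \<open>q + 1\<close> points of \<open>N\<close> then shows that \<open>U\<close> misses
  the conic. Hence every generator meets \<open>N\<close> in exactly one point, and \<open>U\<close> is the graph of a linear
  map from the solid of the directing cubic to the plane of the conic. The map sends \<open>w(t)\<close> to
  \<open>x(t) (1, t, t\<^sup>2)\<close> with coordinates of degree at most 3 in \<open>t\<close>; as \<open>q > 5\<close>,
  the relations between these coordinates are polynomial identities, so \<open>x\<close> is a linear form. Thus the
  twisted cubics on the surface correspond to the linear forms on the projective line: two distinct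
  forms agree at exactly one parameter, and a form is determined by its values at two
  parameters.\<close>

section \<open>Normal rational curves\<close>

text \<open>The functional is the coordinate along \<open>x\<close> in a basis of the whole space
  that extends \<open>x\<close> together with a basis of \<open>S\<close>. It turns membership in a
  subspace into the vanishing of a scalar, so that zeros of polynomials can be counted.\<close>

lemma separating_functional:
  fixes x :: "'a::field ^ 'n"
  assumes S: "vec.subspace S" and x: "x \<notin> S"
  obtains h where "module_hom (*s) (*) h" "\<And>v. v \<in> S \<Longrightarrow> h v = 0" "h x = 1"
proof -
  obtain B where B: "B \<subseteq> S" "vec.independent B" "vec.span B = S"
    using vec.basis_subspace_exists[OF S] by metis
  have indep: "vec.independent (insert x B)"
    using B x by (simp add: vec.independent_insert)
  define B' where "B' = vec.extend_basis (insert x B)"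
  have B': "insert x B \<subseteq> B'" "vec.independent B'" "vec.span B' = UNIV"
    unfolding B'_def
    by (fact vec.extend_basis_superset[OF indep] vec.independent_extend_basis[OF indep]
        vec.span_extend_basis[OF indep])+
  define h where "h v = vec.representation B' v x" for v
  have hom: "module_hom (*s) (*) h"
    by unfold_locales
      (simp_all add: h_def B' vec.representation_add vec.representation_scale algebra_simps)
  interpret h: module_hom "(*s)" "(*)" h by (rule hom)
  have hB: "h v = 0" if "v \<in> B" for v
    using that B' B(1) x vec.representation_basis[OF B'(2), of v] by (auto simp: h_def subset_iff)
  have hS: "h v = 0" if "v \<in> S" for v
    using that unfolding B(3)[symmetric]
    by (induction rule: vec.span_induct_alt) (simp_all add: h.add h.scale hB)
  have "h x = 1"
    using B' by (simp add: h_def vec.representation_basis)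
  with hom hS show ?thesis by (rule that)
qed

lemma dim_span_Un_le_card:
  fixes S :: "('a::field ^ 'n) set"
  assumes "finite A"
  shows "vec.dim (vec.span (S \<union> A)) \<le> vec.dim S + card A"
  using assms
proof (induction A)
  case (insert x A)
  then show ?case
    by (simp add: vec.dim_insert)
qed simp

section \<open>Representative vectors of a normal rational curve, and zeros of functionals along
  it\<close>

definition nrc_vec :: "nat \<Rightarrow> (nat \<Rightarrow> 'a::field ^ 'n) \<Rightarrow> 'a option \<Rightarrow> 'a ^ 'n" where
  "nrc_vec k b \<theta> = (case \<theta> of None \<Rightarrow> b k | Some t \<Rightarrow> \<Sum>i\<le>k. t ^ i *s b i)"

lemma nrc_vec_simps [simp]:
  "nrc_vec k b None = b k"
  "nrc_vec k b (Some t) = (\<Sum>i\<le>k. t ^ i *s b i)"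
  by (simp_all add: nrc_vec_def)

lemma nrc_point_eq: "nrc_point k b \<theta> = vec.span {nrc_vec k b \<theta>}"
  by (cases \<theta>) (simp_all add: nrc_point_def)

lemma nrc_vec_in_subspace:
  "vec.subspace S \<Longrightarrow> (\<And>i. i \<le> k \<Longrightarrow> b i \<in> S) \<Longrightarrow> nrc_vec k b \<theta> \<in> S"
  by (cases \<theta>) (auto intro!: vec.subspace_sum vec.subspace_scale)

text \<open>Along the curve \<open>h\<close> is a polynomial of degree at most \<open>k\<close> with
  coefficients \<open>h (b i)\<close>. More than \<open>k\<close> zeros make it the zero polynomial,
  where a zero at infinity is the vanishing of the coefficient of degree \<open>k\<close>.\<close>

lemma functional_vanishing_on_nrc:
  fixes T :: "'a::field option set"
  assumes h: "module_hom (*s) (*) h"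
    and T: "card T > k" "\<And>\<theta>. \<theta> \<in> T \<Longrightarrow> h (nrc_vec k b \<theta>) = 0" and i: "i \<le> k"
  shows "h (b i) = 0"
proof -
  interpret h: module_hom "(*s)" "(*)" h by (rule h)
  have fin: "finite T" using T(1) card.infinite by fastforce
  define p where "p = (\<Sum>i\<le>k. monom (h (b i)) i)"
  have coeff_p: "poly.coeff p i = h (b i)" if "i \<le> k" for i
    using that by (simp add: p_def coeff_sum)
  have deg: "degree p \<le> k"
    unfolding p_def by (rule degree_sum_le) (auto intro: order.trans[OF degree_monom_le])
  have eval: "poly p t = h (nrc_vec k b (Some t))" for t
    by (simp add: p_def poly_sum poly_monom h.sum h.scale mult.commute)
  define R where "R = {t. Some t \<in> T}"
  have R: "T - {None} = Some ` R"
  proof (intro equalityI subsetI)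
    fix \<theta> assume "\<theta> \<in> T - {None}"
    then show "\<theta> \<in> Some ` R" by (cases \<theta>) (simp_all add: R_def)
  qed (auto simp: R_def)
  have cardR: "card R = card (T - {None})"
    unfolding R by (simp add: card_image)
  have root: "poly p t = poly 0 t" if "t \<in> R" for t
    using T(2)[of "Some t"] that by (simp add: eval R_def del: nrc_vec_simps)
  have "p = 0"
  \<comment> \<open>With infinity in \<open>T\<close> only \<open>k\<close> finite zeros are
    guaranteed; the vanishing coefficient of degree \<open>k\<close> makes up for the missing
    one.\<close>
  proof (cases "None \<in> T")
    case True
    then have "poly.coeff p k = poly.coeff 0 k"
      using T(2)[of None] by (simp add: coeff_p)
    moreover have "card R \<ge> k"
      using True T(1) fin by (simp add: cardR)
    ultimately show ?thesis
      by (rule poly_eqI_degree_lead_coeff) (use deg root in auto)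
  next
    case False
    then have "card R > k"
      using T(1) by (simp add: cardR)
    then show ?thesis
      using deg by (intro poly_eqI_degree[OF root]) auto
  qed
  then show ?thesis
    using coeff_p[OF i] by simp
qed

text \<open>Otherwise a functional that is zero on \<open>S\<close> and 1 at \<open>b i\<close>
  would have more than \<open>k\<close> zeros on the curve.\<close>

lemma nrc_frame_in_subspace:
  fixes T :: "'a::field option set"
  assumes S: "vec.subspace S"
    and T: "card T > k" "\<And>\<theta>. \<theta> \<in> T \<Longrightarrow> nrc_vec k b \<theta> \<in> S" and i: "i \<le> k"
  shows "b i \<in> S"
proof (rule ccontr)
  assume "b i \<notin> S"
  with S obtain h where h: "module_hom (*s) (*) h" "\<And>v. v \<in> S \<Longrightarrow> h v = 0" "h (b i) = 1"
    by (rule separating_functional) blast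
  have "h (b i) = 0"
    by (rule functional_vanishing_on_nrc[OF h(1) T(1) _ i]) (simp add: h(2) T(2))
  with h(3) show False by simp
qed

lemma pg_frame_iff_span:
  assumes "vec.dim U = k + 1"
  shows "pg_frame k U b \<longleftrightarrow> vec.span (b ` {..k}) = U"
proof
  assume span: "vec.span (b ` {..k}) = U"
  have "vec.dim U \<le> card (b ` {..k})"
    unfolding span[symmetric] by (simp add: vec.dim_le_card')
  moreover have "card (b ` {..k}) \<le> k + 1"
    using card_image_le[of "{..k}" b] by simp
  ultimately have card: "card (b ` {..k}) = k + 1"
    using assms by simp
  then have "inj_on b {..k}"
    by (intro eq_card_imp_inj_on) auto
  moreover have "vec.independent (b ` {..k})"
    using card assms span
    by (intro vec.card_le_dim_spanning[of _ U]) (auto simp: vec.span_base)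
  ultimately show "pg_frame k U b"
    using span by (simp add: pg_frame_def)
qed (simp add: pg_frame_def)

lemma pg_frame_dim: "pg_frame k U b \<Longrightarrow> vec.dim U = k + 1"
  by (auto simp: pg_frame_def vec.dim_eq_card_independent card_image)

lemma pg_frame_subspace: "pg_frame k U b \<Longrightarrow> vec.subspace U"
  by (auto simp: pg_frame_def)

lemma nrc_point_subset:
  assumes "pg_frame k U b"
  shows "nrc_point k b \<theta> \<subseteq> U"
proof -
  have "b i \<in> U" if "i \<le> k" for i
    using assms that by (auto simp: pg_frame_def intro: vec.span_base)
  then have "nrc_vec k b \<theta> \<in> U"
    using pg_frame_subspace[OF assms] by (intro nrc_vec_in_subspace)
  then show ?thesis
    unfolding nrc_point_eq using pg_frame_subspace[OF assms] by (intro vec.span_minimal) auto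
qed

section \<open>Independence of points on a normal rational curve\<close>

lemma obtain_disjoint_with_card:
  fixes T :: "'b::finite set"
  assumes "card T \<le> n" "n \<le> CARD('b)"
  obtains R where "R \<inter> T = {}" "card R = n - card T" "card (T \<union> R) = n"
proof -
  have "n - card T \<le> card (- T)"
    using assms by (simp add: card_Diff_subset Compl_eq_Diff_UNIV)
  then obtain R where R: "R \<subseteq> - T" "card R = n - card T"
    using obtain_subset_with_card_n by metis
  moreover have "card (T \<union> R) = n"
    using R assms by (subst card_Un_disjoint) auto
  ultimately show ?thesis
    using that by blast
qed

text \<open>This states the independence of up to \<open>k + 1\<close> points of the curve as a
  dimension bound. Completing \<open>T\<close> to \<open>k + 1\<close> parameters adds at most
  \<open>k + 1 - card T\<close> dimensions to \<open>S\<close>, and the result contains all of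
  \<open>U\<close>. The bound on \<open>k\<close> ensures that there are \<open>k + 1\<close>
  parameters, infinity included.\<close>

lemma nrc_points_le_dim:
  fixes T :: "'a::{field,finite} option set"
  assumes b: "pg_frame k U b" and S: "vec.subspace S"
    and T: "card T \<le> k + 1" "\<And>\<theta>. \<theta> \<in> T \<Longrightarrow> nrc_vec k b \<theta> \<in> S" and q: "k \<le> CARD('a)"
  shows "card T \<le> vec.dim S"
proof -
  obtain R where R: "card R = k + 1 - card T" "card (T \<union> R) = k + 1"
    using obtain_disjoint_with_card[of T "k + 1"] T(1) q by auto
  define S' where "S' = vec.span (S \<union> nrc_vec k b ` R)"
  have "b i \<in> S'" if "i \<le> k" for i
    by (rule nrc_frame_in_subspace[of _ k "T \<union> R", OF _ _ _ that])
      (use R T(2) in \<open>auto simp: S'_def vec.span_base\<close>)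
  then have "U \<subseteq> S'"
    using b vec.span_minimal[of "b ` {..k}" S'] by (auto simp: pg_frame_def S'_def)
  then have "k + 1 \<le> vec.dim S'"
    using pg_frame_dim[OF b] vec.dim_subset by metis
  also have "\<dots> \<le> vec.dim S + card (nrc_vec k b ` R)"
    unfolding S'_def by (rule dim_span_Un_le_card) simp
  also have "card (nrc_vec k b ` R) \<le> k + 1 - card T"
    using card_image_le[of R "nrc_vec k b"] R by simp
  finally show ?thesis
    using T(1) by simp
qed

lemma nrc_point_inj:
  fixes b :: "nat \<Rightarrow> 'a::{field,finite} ^ 'n"
  assumes b: "pg_frame k U b" and k: "0 < k" "k \<le> CARD('a)"
  shows "inj (nrc_point k b)"
proof (rule injI, rule ccontr)
  fix \<theta> \<theta>' assume eq: "nrc_point k b \<theta> = nrc_point k b \<theta>'" and ne: "\<theta> \<noteq> \<theta>'"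
  have "card {\<theta>, \<theta>'} \<le> vec.dim (nrc_point k b \<theta>)"
  proof (rule nrc_points_le_dim[OF b _ _ _ k(2)])
    show "card {\<theta>, \<theta>'} \<le> k + 1" using ne k by simp
    show "nrc_vec k b \<rho> \<in> nrc_point k b \<theta>" if "\<rho> \<in> {\<theta>, \<theta>'}" for \<rho>
    proof -
      have "nrc_vec k b \<rho> \<in> nrc_point k b \<rho>"
        by (simp add: nrc_point_eq vec.span_base)
      with that eq show ?thesis by blast
    qed
  qed (simp add: nrc_point_eq)
  also have "\<dots> \<le> 1" by (simp add: nrc_point_eq)
  finally show False using ne by simp
qed

text \<open>One point more would give \<open>vec.dim S + 1\<close> independent points inside
  \<open>S\<close>. For a twisted cubic this bounds the points on a line by two and those in a plane
  by three.\<close>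

lemma nrc_Int_subspace_card_le:
  fixes b :: "nat \<Rightarrow> 'a::{field,finite} ^ 'n"
  assumes b: "pg_frame k U b" and S: "vec.subspace S" "vec.dim S \<le> k"
    and k: "0 < k" "k \<le> CARD('a)"
  shows "card {P \<in> range (nrc_point k b). P \<subseteq> S} \<le> vec.dim S"
proof (rule ccontr)
  assume "\<not> ?thesis"
  define T where "T = {\<theta>. nrc_vec k b \<theta> \<in> S}"
  have "{P \<in> range (nrc_point k b). P \<subseteq> S} \<subseteq> nrc_point k b ` T"
    by (auto simp: T_def nrc_point_eq intro!: imageI intro: vec.span_base)
  then have "card {P \<in> range (nrc_point k b). P \<subseteq> S} \<le> card T"
    by (rule surj_card_le[rotated]) simp
  with \<open>\<not> ?thesis\<close> have "vec.dim S + 1 \<le> card T" by simp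
  then obtain T' where T': "T' \<subseteq> T" "card T' = vec.dim S + 1"
    using obtain_subset_with_card_n by metis
  have "card T' \<le> vec.dim S"
    by (rule nrc_points_le_dim[OF b S(1) _ _ k(2)]) (use T' S in \<open>auto simp: T_def\<close>)
  with T' show False by simp
qed

section \<open>Points, lines and reparametrisation\<close>

text \<open>Degree bounds are used instead of degrees because the linear factors to which this is
  applied may be constant.\<close>

lemma coeff_mult_degree_le:
  fixes f g :: "'a::comm_semiring_0 poly"
  assumes "degree f \<le> m" "degree g \<le> n"
  shows "poly.coeff (f * g) (m + n) = poly.coeff f m * poly.coeff g n"
proof (cases "degree f = m \<and> degree g = n")
  case True
  then show ?thesis using coeff_mult_degree_sum[of f g] by simp
next
  case False
  then have "degree (f * g) < m + n"
    using degree_mult_le[of f g] assms by linarith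
  moreover have "poly.coeff f m = 0 \<or> poly.coeff g n = 0"
    using False assms by (auto simp: coeff_eq_0)
  ultimately show ?thesis
    by (auto simp: coeff_eq_0)
qed

lemma degree_linear_power_le: "degree ([:r, p:] ^ j) \<le> j"
  using degree_power_le[of "[:r, p:]" j] by (auto split: if_splits intro: order.trans)

lemma coeff_linear_power_top: "poly.coeff ([:r, p:] ^ j) j = p ^ j"
proof (induction j)
  case (Suc j)
  have "poly.coeff ([:r, p:] * [:r, p:] ^ j) (1 + j) = poly.coeff [:r, p:] 1 * poly.coeff ([:r, p:] ^ j) j"
    by (rule coeff_mult_degree_le) (auto simp: degree_linear_power_le)
  with Suc show ?case by simp
qed simp

section \<open>Points and lines described by spanning vectors\<close>

lemma span_scale_singleton:
  fixes v :: "'a::field ^ 'n"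
  assumes "x \<noteq> 0"
  shows "vec.span {x *s v} = vec.span {v}"
proof -
  have "v \<in> vec.span {x *s v}"
    using vec.span_scale[of "x *s v" "{x *s v}" "inverse x"] assms by (simp add: vec.span_base)
  then show ?thesis
    by (simp add: vec.span_eq vec.span_base vec.span_scale)
qed

lemma pg_subspace_0_iff:
  fixes P :: "('a::field ^ 'n) set"
  shows "pg_subspace 0 P \<longleftrightarrow> (\<exists>v. v \<noteq> 0 \<and> P = vec.span {v})"
proof
  assume P: "pg_subspace 0 P"
  then obtain B where B: "vec.span B = P" "card B = 1"
    using vec.basis_subspace_exists[of P] by (metis One_nat_def add_0 pg_subspace_def)
  then obtain v where "B = {v}" by (auto simp: card_1_singleton_iff)
  then show "\<exists>v. v \<noteq> 0 \<and> P = vec.span {v}"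
    using B P by (auto simp: pg_subspace_def split: if_splits)
qed (auto simp: pg_subspace_def)

lemma pg_join_span_singletons: "pg_join (vec.span {u}) (vec.span {w}) = vec.span {u, w}"
proof -
  have "vec.span (vec.span {u} \<union> vec.span {w}) = vec.span {u, w}"
    unfolding vec.span_eq
    using vec.span_mono[of "{u}" "{u, w}"] vec.span_mono[of "{w}" "{u, w}"]
      vec.span_superset[of "{u}"] vec.span_superset[of "{w}"]
      vec.span_superset[of "vec.span {u} \<union> vec.span {w}"]
    by auto
  then show ?thesis by (simp add: pg_join_def)
qed

lemma in_span_pair_iff:
  fixes u w :: "'a::field ^ 'n"
  shows "v \<in> vec.span {u, w} \<longleftrightarrow> (\<exists>x y. v = x *s u + y *s w)"
proof -
  have "v = x *s u + y *s w \<longleftrightarrow> v - x *s u = y *s w" for x y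
    by (auto simp: algebra_simps)
  then show ?thesis
    by (auto simp: vec.span_breakdown_eq vec.span_singleton image_iff)
qed

lemma pg_points_join:
  fixes u w :: "'a::field ^ 'n"
  assumes P: "P \<in> pg_points (pg_join (vec.span {u}) (vec.span {w}))"
  obtains "P = vec.span {u}" | x where "P = vec.span {x *s u + w}"
proof -
  obtain v where v: "v \<noteq> 0" "P = vec.span {v}"
    using P by (auto simp: pg_points_def pg_subspace_0_iff)
  have "v \<in> vec.span {u, w}"
    using P v by (auto simp: pg_points_def pg_join_span_singletons intro: vec.span_base)
  then obtain x y where xy: "v = x *s u + y *s w"
    by (auto simp: in_span_pair_iff)
  show ?thesis
  proof (cases "y = 0")
    case True
    with xy v have "x \<noteq> 0" "P = vec.span {x *s u}" by auto
    then show ?thesis using that(1) by (simp add: span_scale_singleton)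
  next
    case False
    with xy have "v = y *s ((x / y) *s u + w)"
      by (simp add: vec.scale_right_distrib)
    with v False have "P = vec.span {(x / y) *s u + w}"
      by (simp only: span_scale_singleton simp_thms)
    then show ?thesis by (rule that(2))
  qed
qed

text \<open>Substituting the fraction and clearing denominators turns the coefficient of
  \<open>c j\<close> into \<open>(p * t + r) ^ j * (s * t + u) ^ (k - j)\<close>;
  \<open>c' i\<close> collects the terms with \<open>t ^ i\<close>. The scalar \<open>x\<close> is
  the \<open>k\<close>-th power of the denominator, or of the numerator where the denominator
  vanishes.\<close>

lemma nrc_vec_reparametrise:
  fixes c :: "nat \<Rightarrow> 'a::field ^ 'n" and k :: nat
  assumes det: "p * u - r * s \<noteq> 0"
  defines "c' \<equiv> \<lambda>i. \<Sum>j\<le>k. poly.coeff ([:r, p:] ^ j * [:u, s:] ^ (k - j)) i *s c j"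
  obtains x where "x \<noteq> 0" "nrc_vec k c' \<theta> = x *s nrc_vec k c (moebius p r s u \<theta>)"
proof -
  have expand: "(\<Sum>j\<le>k. (y ^ j * z ^ (k - j)) *s c j) = z ^ k *s nrc_vec k c (Some (y / z))"
    if "z \<noteq> 0" for y z
  proof -
    have "y ^ j * z ^ (k - j) = z ^ k * (y / z) ^ j" if "j \<le> k" for j
      using that \<open>z \<noteq> 0\<close> by (simp add: power_diff power_divide)
    then show ?thesis
      by (simp add: vec.scale_sum_right)
  qed
  \<comment> \<open>Since \<open>0 ^ 0 = 1\<close>, exactly the term with \<open>j = k\<close>
    survives, which is the point at infinity.\<close>
  have expand0: "(\<Sum>j\<le>k. (y ^ j * 0 ^ (k - j)) *s c j) = y ^ k *s nrc_vec k c None" for y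
  proof -
    have "(\<Sum>j\<le>k. (y ^ j * 0 ^ (k - j)) *s c j) = (\<Sum>j\<in>{k}. (y ^ j * 0 ^ (k - j)) *s c j)"
      by (rule sum.mono_neutral_right) (auto simp: power_0_left)
    then show ?thesis by simp
  qed
  show ?thesis
  proof (cases \<theta>)
    case None
    \<comment> \<open>The coefficient of degree \<open>k\<close> is the value at infinity of the
      form in homogeneous coordinates.\<close>
    have "poly.coeff ([:r, p:] ^ j * [:u, s:] ^ (k - j)) k = p ^ j * s ^ (k - j)" if "j \<le> k" for j
      using that coeff_mult_degree_le[of "[:r, p:] ^ j" j "[:u, s:] ^ (k - j)" "k - j"]
      by (simp add: degree_linear_power_le coeff_linear_power_top)
    then have eq: "nrc_vec k c' \<theta> = (\<Sum>j\<le>k. (p ^ j * s ^ (k - j)) *s c j)"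
      by (simp add: None c'_def)
    show ?thesis
    proof (cases "s = 0")
      case True
      with det have "p ^ k \<noteq> 0" by auto
      then show ?thesis
        by (rule that) (use eq in \<open>simp only: True expand0 None moebius_def option.case if_True simp_thms\<close>)
    next
      case False
      then have "s ^ k \<noteq> 0" by auto
      then show ?thesis
        by (rule that) (use eq in \<open>simp only: False expand None moebius_def option.case if_False simp_thms\<close>)
    qed
  next
    case (Some t)
    have deg: "degree ([:r, p:] ^ j * [:u, s:] ^ (k - j)) \<le> k" if "j \<le> k" for j
      using degree_mult_le[of "[:r, p:] ^ j" "[:u, s:] ^ (k - j)"] degree_linear_power_le[of r p j]
        degree_linear_power_le[of u s "k - j"] that by linarith
    have "(\<Sum>i\<le>k. t ^ i * poly.coeff ([:r, p:] ^ j * [:u, s:] ^ (k - j)) i)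
        = (p * t + r) ^ j * (s * t + u) ^ (k - j)" if "j \<le> k" for j
    proof -
      have "(\<Sum>i\<le>k. t ^ i * poly.coeff ([:r, p:] ^ j * [:u, s:] ^ (k - j)) i)
          = poly ([:r, p:] ^ j * [:u, s:] ^ (k - j)) t"
        unfolding poly_altdef
        by (rule sum.mono_neutral_cong_right)
          (use deg[OF that] in \<open>auto simp: coeff_eq_0 mult.commute\<close>)
      then show ?thesis by (simp add: algebra_simps)
    qed
    moreover have "nrc_vec k c' \<theta>
      = (\<Sum>j\<le>k. (\<Sum>i\<le>k. t ^ i * poly.coeff ([:r, p:] ^ j * [:u, s:] ^ (k - j)) i) *s c j)"
      by (simp add: Some c'_def vec.scale_sum_right vec.scale_sum_left)
        (rule sum.swap)
    ultimately have eq: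
        "nrc_vec k c' \<theta> = (\<Sum>j\<le>k. ((p * t + r) ^ j * (s * t + u) ^ (k - j)) *s c j)"
      by simp
    show ?thesis
    proof (cases "s * t + u = 0")
      case True
      have "p * t + r \<noteq> 0"
      proof
        assume "p * t + r = 0"
        then have "r = - (p * t)" "u = - (s * t)"
          using True by (simp_all add: eq_neg_iff_add_eq_0 add.commute)
        with det show False by (simp add: algebra_simps)
      qed
      then have "(p * t + r) ^ k \<noteq> 0" by simp
      then show ?thesis
        by (rule that) (use eq in \<open>simp only: True expand0 Some moebius_def option.case if_True simp_thms\<close>)
    next
      case False
      then have "(s * t + u) ^ k \<noteq> 0" by simp
      then show ?thesis
        by (rule that) (use eq in \<open>simp only: False expand Some moebius_def option.case if_False simp_thms\<close>)
    qed
  qed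
qed

text \<open>The adjugate matrix gives a right inverse: the product of the two matrices is the
  determinant times the identity, and that scalar cancels.\<close>

lemma moebius_surj:
  fixes p r s u :: "'a::field"
  assumes det: "p * u - r * s \<noteq> 0"
  shows "surj (moebius p r s u)"
proof (rule surjI)
  fix \<epsilon> :: "'a option"
  show "moebius p r s u (moebius u (- r) (- s) p \<epsilon>) = \<epsilon>"
  proof (cases \<epsilon>)
    case None
    then show ?thesis using det
      by (auto simp: moebius_def divide_simps)
  next
    case (Some e)
    show ?thesis
    proof (cases "p - s * e = 0")
      case True
      then have "p = s * e" by simp
      with det have "s \<noteq> 0" by auto
      then show ?thesis
        using True by (simp add: Some moebius_def \<open>p = s * e\<close>)
    next
      case False
      define z where "z = p - s * e"
      have z: "z \<noteq> 0" using False by (simp add: z_def)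
      have den: "s * ((u * e - r) / z) + u = (p * u - r * s) / z"
        using z by (simp add: field_simps) (simp add: z_def algebra_simps)
      have num: "p * ((u * e - r) / z) + r = e * (p * u - r * s) / z"
        using z by (simp add: field_simps) (simp add: z_def algebra_simps)
      have "moebius u (- r) (- s) p \<epsilon> = Some ((u * e - r) / z)"
        using z by (simp add: Some moebius_def z_def algebra_simps)
      moreover have "moebius p r s u (Some ((u * e - r) / z)) = Some e"
        unfolding moebius_def option.case den num using z det by simp
      ultimately show ?thesis by (simp add: Some)
    qed
  qed
qed

text \<open>This absorbs \<phi> into the frame. The new vectors form a frame because \<phi> is
  surjective: their span contains every point of the old curve, hence the old frame.\<close>

lemma nrc_reparametrise:
  fixes c :: "nat \<Rightarrow> 'a::{field,finite} ^ 'n"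
  assumes \<phi>: "\<phi> \<in> PGL2" and c: "pg_frame k U c" and k: "k \<le> CARD('a)"
  obtains c' where "pg_frame k U c'" "\<And>\<theta>. nrc_point k c' \<theta> = nrc_point k c (\<phi> \<theta>)"
proof -
  obtain p r s u where det: "p * u - r * s \<noteq> 0" and \<phi>_eq: "\<phi> = moebius p r s u"
    using \<phi> by (auto simp: PGL2_def)
  define c' where "c' = (\<lambda>i. \<Sum>j\<le>k. poly.coeff ([:r, p:] ^ j * [:u, s:] ^ (k - j)) i *s c j)"
  have point: "nrc_point k c' \<theta> = nrc_point k c (\<phi> \<theta>)" for \<theta>
  proof -
    obtain x where "x \<noteq> 0" "nrc_vec k c' \<theta> = x *s nrc_vec k c (moebius p r s u \<theta>)"
      unfolding c'_def by (rule nrc_vec_reparametrise[OF det])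
    then show ?thesis
      by (simp add: nrc_point_eq \<phi>_eq span_scale_singleton)
  qed
  have U: "U = vec.span (c ` {..k})" "vec.dim U = k + 1"
    using c pg_frame_dim[OF c] by (simp_all add: pg_frame_def)
  have "c i \<in> vec.span (c' ` {..k})" if "i \<le> k" for i
  proof (rule nrc_frame_in_subspace[of _ k UNIV, OF _ _ _ that])
    show "nrc_vec k c \<epsilon> \<in> vec.span (c' ` {..k})" for \<epsilon>
    proof -
      obtain \<theta> where "\<epsilon> = \<phi> \<theta>"
        using moebius_surj[OF det] unfolding \<phi>_eq by blast
      then have "nrc_vec k c \<epsilon> \<in> vec.span {nrc_vec k c' \<theta>}"
        using point[of \<theta>] by (auto simp: nrc_point_eq intro: vec.span_base)
      moreover have "nrc_vec k c' \<theta> \<in> vec.span (c' ` {..k})"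
        by (intro nrc_vec_in_subspace) (auto intro: vec.span_base)
      ultimately show ?thesis
        using vec.span_minimal[of "{nrc_vec k c' \<theta>}" "vec.span (c' ` {..k})"] by auto
    qed
  qed (use k in auto)
  moreover have "c' i \<in> U" for i
    unfolding c'_def U by (auto intro!: vec.span_sum vec.span_scale intro: vec.span_base)
  ultimately have "vec.span (c' ` {..k}) = U"
    unfolding U vec.span_eq by auto
  then have "pg_frame k U c'"
    using U pg_frame_iff_span by blast
  with point show ?thesis by (rule that[rotated])
qed

section \<open>Coordinates on the scroll\<close>

lemma pg_frame_of_dual:
  fixes d :: "nat \<Rightarrow> 'a::field ^ 'n"
  assumes hom: "\<And>i. module_hom (*s) (*) (\<gamma> i)"
    and dual: "\<And>i j. i \<le> k \<Longrightarrow> j \<le> k \<Longrightarrow> \<gamma> i (d j) = (if i = j then 1 else 0)"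
  shows "pg_frame k (vec.span (d ` {..k})) d"
proof -
  have inj: "inj_on d {..k}"
  proof (rule inj_onI)
    fix i j assume ij: "i \<in> {..k}" "j \<in> {..k}" "d i = d j"
    then have "(if i = j then 1 else 0 :: 'a) = 1"
      using dual[of i j] dual[of i i] by simp
    then show "i = j" by (simp split: if_splits)
  qed
  have "\<not> vec.dependent (d ` {..k})"
  proof
    assume "vec.dependent (d ` {..k})"
    then obtain r i where r: "(\<Sum>v\<in>d ` {..k}. r v *s v) = 0" and i: "i \<le> k" "r (d i) \<noteq> 0"
      by (auto simp: vec.dependent_finite)
    interpret g: module_hom "(*s)" "(*)" "\<gamma> i" by (rule hom)
    have "0 = \<gamma> i (\<Sum>v\<in>d ` {..k}. r v *s v)" by (simp add: r)
    also have "\<dots> = (\<Sum>j\<le>k. r (d j) * \<gamma> i (d j))"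
      by (simp add: g.sum g.scale sum.reindex[OF inj])
    also have "\<dots> = (\<Sum>j\<le>k. if i = j then r (d j) else 0)"
      using i by (intro sum.cong) (auto simp: dual)
    also have "\<dots> = r (d i)" using i by simp
    finally show False using i by simp
  qed
  with inj show ?thesis by (simp add: pg_frame_def)
qed

lemma span_frame_expand:
  fixes d :: "nat \<Rightarrow> 'a::field ^ 'n"
  assumes hom: "\<And>i. module_hom (*s) (*) (\<gamma> i)"
    and dual: "\<And>i j. i \<le> k \<Longrightarrow> j \<le> k \<Longrightarrow> \<gamma> i (d j) = (if i = j then 1 else 0)"
    and v: "v \<in> vec.span (d ` {..k})"
  shows "v = (\<Sum>j\<le>k. \<gamma> j v *s d j)"
proof -
  have inj: "inj_on d {..k}"
    using pg_frame_of_dual[of \<gamma> k d, OF hom dual] by (simp add: pg_frame_def)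
  obtain r where "v = (\<Sum>x\<in>d ` {..k}. r x *s x)"
    using v by (auto simp: vec.span_finite)
  then have v_eq: "v = (\<Sum>j\<le>k. r (d j) *s d j)"
    by (simp add: sum.reindex[OF inj])
  have "\<gamma> i v = r (d i)" if "i \<le> k" for i
  proof -
    interpret g: module_hom "(*s)" "(*)" "\<gamma> i" by (rule hom)
    have "\<gamma> i v = (\<Sum>j\<le>k. r (d j) * \<gamma> i (d j))"
      by (simp add: v_eq g.sum g.scale)
    also have "\<dots> = (\<Sum>j\<le>k. if i = j then r (d j) else 0)"
      using that by (intro sum.cong) (auto simp: dual)
    finally show ?thesis using that by simp
  qed
  then show ?thesis using v_eq by simp
qed

text \<open>A linear form on the projective line, evaluated at \<open>(1, t)\<close> and at \<open>(0, 1)\<close>.\<close>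

definition line_form :: "'a::field \<Rightarrow> 'a \<Rightarrow> 'a option \<Rightarrow> 'a" where
  "line_form l m \<theta> = (case \<theta> of None \<Rightarrow> m | Some t \<Rightarrow> l + m * t)"

lemma line_form_interpolate:
  assumes "\<theta> \<noteq> \<theta>'"
  obtains l m where "line_form l m \<theta> = x" "line_form l m \<theta>' = y"
proof -
  consider (a) t where "\<theta> = None" "\<theta>' = Some t" | (b) t where "\<theta> = Some t" "\<theta>' = None"
    | (c) s t where "\<theta> = Some s" "\<theta>' = Some t" "s \<noteq> t"
    using assms by (cases \<theta>; cases \<theta>') auto
  then show ?thesis
  proof cases
    case a
    then show ?thesis by (intro that[of "y - x * t" x]) (auto simp: line_form_def)
  next
    case b
    then show ?thesis by (intro that[of "x - y * t" y]) (auto simp: line_form_def)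
  next
    case c
    define m where "m = (x - y) / (s - t)"
    have "m * (s - t) = x - y" using c by (simp add: m_def)
    then show ?thesis
      using c by (intro that[of "x - m * s" m]) (auto simp: line_form_def algebra_simps)
  qed
qed

lemma line_form_unique:
  assumes "\<theta> \<noteq> \<theta>'"
    and "line_form l m \<theta> = line_form l' m' \<theta>" "line_form l m \<theta>' = line_form l' m' \<theta>'"
  shows "l = l' \<and> m = m'"
proof (cases "m = m'")
  case True
  then show ?thesis
    using assms by (cases \<theta>; cases \<theta>') (auto simp: line_form_def)
next
  case False
  then obtain s t where st: "\<theta> = Some s" "\<theta>' = Some t" "s \<noteq> t"
    using assms by (cases \<theta>; cases \<theta>') (auto simp: line_form_def)
  have "(m - m') * (s - t) = (l + m * s - (l' + m' * s)) - (l + m * t - (l' + m' * t))"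
    by (simp add: algebra_simps)
  also have "\<dots> = 0"
    using assms st by (simp add: line_form_def)
  finally have "(m - m') * (s - t) = 0" .
  with False st show ?thesis by simp
qed

text \<open>Forms with the same slope agree at infinity, where the value is the slope; otherwise the
  linear equation for \<open>t\<close> is solvable.\<close>

lemma line_form_meet: "\<exists>\<theta>. line_form l m \<theta> = line_form l' m' \<theta>"
proof (cases "m = m'")
  case True
  then show ?thesis by (intro exI[of _ None]) (simp add: line_form_def)
next
  case False
  define t where "t = (l' - l) / (m - m')"
  have "l + m * t - (l' + m' * t) = (m - m') * t - (l' - l)"
    by (simp add: algebra_simps)
  also have "\<dots> = 0"
    using False by (simp add: t_def)
  finally have "line_form l m (Some t) = line_form l' m' (Some t)"
    by (simp add: line_form_def)
  then show ?thesis ..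
qed

text \<open>The functionals \<beta> and \<gamma> are the coordinates with respect to the basis of
  the whole space formed by the frames of the conic and of the cubic. The frame \<open>c\<close> is
  understood to be reparametrised already, so that generators join points with equal
  parameters.\<close>

locale quintic_scroll =
  fixes b c :: "nat \<Rightarrow> 'a::{field,finite} ^ 7" and \<beta> \<gamma> :: "nat \<Rightarrow> 'a ^ 7 \<Rightarrow> 'a"
  assumes q: "CARD('a) \<ge> 6"
    and \<beta>_hom: "\<And>i. module_hom (*s) (*) (\<beta> i)"
    and \<gamma>_hom: "\<And>i. module_hom (*s) (*) (\<gamma> i)"
    and \<beta>_b: "\<And>i j. i \<le> 2 \<Longrightarrow> j \<le> 2 \<Longrightarrow> \<beta> i (b j) = (if i = j then 1 else 0)"
    and \<beta>_c: "\<And>i j. i \<le> 2 \<Longrightarrow> j \<le> 3 \<Longrightarrow> \<beta> i (c j) = 0"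
    and \<gamma>_b: "\<And>i j. i \<le> 3 \<Longrightarrow> j \<le> 2 \<Longrightarrow> \<gamma> i (b j) = 0"
    and \<gamma>_c: "\<And>i j. i \<le> 3 \<Longrightarrow> j \<le> 3 \<Longrightarrow> \<gamma> i (c j) = (if i = j then 1 else 0)"
    and expand: "\<And>v. v = (\<Sum>i\<le>2. \<beta> i v *s b i) + (\<Sum>j\<le>3. \<gamma> j v *s c j)"
begin

lemmas \<beta>_linear =
  module_hom.zero[OF \<beta>_hom] module_hom.add[OF \<beta>_hom]
  module_hom.scale[OF \<beta>_hom] module_hom.sum[OF \<beta>_hom]

lemmas \<gamma>_linear =
  module_hom.zero[OF \<gamma>_hom] module_hom.add[OF \<gamma>_hom]
  module_hom.scale[OF \<gamma>_hom] module_hom.sum[OF \<gamma>_hom]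

text \<open>Normalising the cubic component to 1 makes \<open>x\<close> an affine coordinate on the
  generator, with the point of the conic as its point at infinity.\<close>

definition vec_on :: "'a option \<Rightarrow> 'a \<Rightarrow> 'a ^ 7" where
  "vec_on \<theta> x = x *s nrc_vec 2 b \<theta> + nrc_vec 3 c \<theta>"

definition generator :: "'a option \<Rightarrow> ('a ^ 7) set" where
  "generator \<theta> = pg_join (nrc_point 2 b \<theta>) (nrc_point 3 c \<theta>)"

definition surface :: "('a ^ 7) set set" where
  "surface = (\<Union>\<theta>. pg_points (generator \<theta>))"

section \<open>Coordinates of the points of the surface\<close>

lemma \<beta>_conic:
  "i \<le> 2 \<Longrightarrow> \<beta> i (nrc_vec 2 b \<theta>) = (case \<theta> of None \<Rightarrow> if i = 2 then 1 else 0 | Some t \<Rightarrow> t ^ i)"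
proof (cases \<theta>)
  case (Some t)
  assume i: "i \<le> 2"
  have "\<beta> i (nrc_vec 2 b \<theta>) = (\<Sum>j\<le>2. if i = j then t ^ j else 0)"
    unfolding Some nrc_vec_simps \<beta>_linear
    using i by (intro sum.cong) (auto simp: \<beta>_b)
  with i show ?thesis by (simp add: Some)
qed (simp add: \<beta>_b)

lemma \<beta>_cubic: "i \<le> 2 \<Longrightarrow> \<beta> i (nrc_vec 3 c \<theta>) = 0"
  by (cases \<theta>) (auto simp: \<beta>_linear \<beta>_c intro!: sum.neutral)

lemma \<gamma>_conic: "i \<le> 3 \<Longrightarrow> \<gamma> i (nrc_vec 2 b \<theta>) = 0"
  by (cases \<theta>) (auto simp: \<gamma>_linear \<gamma>_b intro!: sum.neutral)

lemma \<gamma>_cubic: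
  "i \<le> 3 \<Longrightarrow> \<gamma> i (nrc_vec 3 c \<theta>) = (case \<theta> of None \<Rightarrow> if i = 3 then 1 else 0 | Some t \<Rightarrow> t ^ i)"
proof (cases \<theta>)
  case (Some t)
  assume i: "i \<le> 3"
  have "\<gamma> i (nrc_vec 3 c \<theta>) = (\<Sum>j\<le>3. if i = j then t ^ j else 0)"
    unfolding Some nrc_vec_simps \<gamma>_linear
    using i by (intro sum.cong) (auto simp: \<gamma>_c)
  with i show ?thesis by (simp add: Some)
qed (simp add: \<gamma>_c)

lemma \<beta>_vec_on:
  "i \<le> 2 \<Longrightarrow> \<beta> i (vec_on \<theta> x) = (case \<theta> of None \<Rightarrow> if i = 2 then x else 0 | Some t \<Rightarrow> x * t ^ i)"
  by (simp add: vec_on_def \<beta>_linear \<beta>_conic \<beta>_cubic split: option.split)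

lemma \<gamma>_vec_on:
  "i \<le> 3 \<Longrightarrow> \<gamma> i (vec_on \<theta> x) = (case \<theta> of None \<Rightarrow> if i = 3 then 1 else 0 | Some t \<Rightarrow> t ^ i)"
  by (simp add: vec_on_def \<gamma>_linear \<gamma>_conic \<gamma>_cubic split: option.split)

lemma vec_on_nonzero: "vec_on \<theta> x \<noteq> 0"
proof
  assume "vec_on \<theta> x = 0"
  then have "\<gamma> i (vec_on \<theta> x) = 0" for i
    by (simp add: \<gamma>_linear)
  from this[of 0] this[of 3] show False by (cases \<theta>) (auto simp: \<gamma>_vec_on)
qed

lemma span_vec_on_inj:
  assumes "vec.span {vec_on \<theta> x} = vec.span {vec_on \<theta>' x'}"
  shows "\<theta> = \<theta>' \<and> x = x'"
proof -
  have "vec_on \<theta> x \<in> vec.span {vec_on \<theta>' x'}"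
    unfolding assms[symmetric] by (simp add: vec.span_base)
  then obtain r where r: "vec_on \<theta> x = r *s vec_on \<theta>' x'"
    by (auto simp: vec.span_singleton)
  then have \<gamma>: "\<gamma> i (vec_on \<theta> x) = r * \<gamma> i (vec_on \<theta>' x')"
    and \<beta>: "\<beta> i (vec_on \<theta> x) = r * \<beta> i (vec_on \<theta>' x')" for i
    by (simp_all add: \<gamma>_linear \<beta>_linear)
  \<comment> \<open>Coordinate 0 separates finite parameters from infinity and fixes the scalar at
    finite ones, coordinate 1 recovers \<open>t\<close>, and coordinate 3 fixes the scalar at
    infinity.\<close>
  from \<gamma>[of 0] \<gamma>[of 1] \<gamma>[of 3] have "\<theta> = \<theta>' \<and> r = 1"
    by (cases \<theta>; cases \<theta>') (auto simp: \<gamma>_vec_on)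
  with \<beta>[of 0] \<beta>[of 2] show ?thesis
    by (cases \<theta>) (auto simp: \<beta>_vec_on)
qed

lemma generator_eq: "generator \<theta> = vec.span {nrc_vec 2 b \<theta>, nrc_vec 3 c \<theta>}"
  by (simp add: generator_def nrc_point_eq pg_join_span_singletons)

lemma vec_on_in_generator: "vec_on \<theta> x \<in> generator \<theta>"
  by (simp add: generator_eq vec_on_def vec.span_add vec.span_scale vec.span_base)

lemma span_vec_on_in_points: "vec.span {vec_on \<theta> x} \<in> pg_points (generator \<theta>)"
proof -
  have "vec.span {vec_on \<theta> x} \<subseteq> generator \<theta>"
    using vec_on_in_generator by (intro vec.span_minimal) (auto simp: generator_eq)
  then show ?thesis
    using vec_on_nonzero by (auto simp: pg_points_def pg_subspace_0_iff)
qed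

lemma points_generator_cases:
  assumes "P \<in> pg_points (generator \<theta>)"
  obtains "P = nrc_point 2 b \<theta>" | x where "P = vec.span {vec_on \<theta> x}"
  using pg_points_join[of P "nrc_vec 2 b \<theta>" "nrc_vec 3 c \<theta>"] assms
  by (auto simp: generator_def nrc_point_eq vec_on_def)

lemma eq_UNIV_if_basis:
  assumes "vec.subspace S" "\<And>i. i \<le> 2 \<Longrightarrow> b i \<in> S" "\<And>j. j \<le> 3 \<Longrightarrow> c j \<in> S"
  shows "S = UNIV"
proof -
  have "v \<in> S" for v
    by (subst expand) (use assms in \<open>auto intro!: vec.subspace_add vec.subspace_sum vec.subspace_scale\<close>)
  then show ?thesis by auto
qed

text \<open>Completing the given points by \<open>3 - card T\<^sub>1\<close> points of the conic and
  \<open>4 - card T\<^sub>2\<close> points of the cubic produces a spanning set of the whole space.\<close>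

lemma scroll_points_le_dim:
  assumes S: "vec.subspace S"
    and T\<^sub>1: "card T\<^sub>1 \<le> 3" "\<And>\<theta>. \<theta> \<in> T\<^sub>1 \<Longrightarrow> nrc_vec 2 b \<theta> \<in> S"
    and T\<^sub>2: "card T\<^sub>2 \<le> 4" "\<And>\<theta>. \<theta> \<in> T\<^sub>2 \<Longrightarrow> \<exists>x. vec_on \<theta> x \<in> S"
  shows "card T\<^sub>1 + card T\<^sub>2 \<le> vec.dim S"
proof -
  obtain R\<^sub>1 where R\<^sub>1: "card R\<^sub>1 = 3 - card T\<^sub>1" "card (T\<^sub>1 \<union> R\<^sub>1) = 3"
    using obtain_disjoint_with_card[of T\<^sub>1 3] T\<^sub>1(1) q by auto
  obtain R\<^sub>2 where R\<^sub>2: "card R\<^sub>2 = 4 - card T\<^sub>2" "card (T\<^sub>2 \<union> R\<^sub>2) = 4"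
    using obtain_disjoint_with_card[of T\<^sub>2 4] T\<^sub>2(1) q by auto
  define A where "A = nrc_vec 2 b ` R\<^sub>1 \<union> nrc_vec 3 c ` R\<^sub>2"
  define S' where "S' = vec.span (S \<union> A)"
  have S': "vec.subspace S'" "S \<subseteq> S'" "A \<subseteq> S'"
    using vec.span_superset[of "S \<union> A"] by (auto simp: S'_def)
  have b: "b i \<in> S'" if "i \<le> 2" for i
    by (rule nrc_frame_in_subspace[of _ 2 "T\<^sub>1 \<union> R\<^sub>1", OF S'(1) _ _ that])
      (use R\<^sub>1 T\<^sub>1(2) S' in \<open>auto simp: A_def\<close>)
  \<comment> \<open>The whole plane of the conic lies in \<open>S'\<close> by now, so the conic
    component of a given point may be subtracted.\<close>
  have cubic: "nrc_vec 3 c \<theta> \<in> S'" if \<theta>: "\<theta> \<in> T\<^sub>2" for \<theta>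
  proof -
    obtain x where "vec_on \<theta> x \<in> S'" using T\<^sub>2(2)[OF \<theta>] S' by auto
    moreover have "nrc_vec 2 b \<theta> \<in> S'"
      using S'(1) b by (rule nrc_vec_in_subspace)
    ultimately have "vec_on \<theta> x - x *s nrc_vec 2 b \<theta> \<in> S'"
      using S'(1) by (intro vec.subspace_diff vec.subspace_scale)
    then show ?thesis by (simp add: vec_on_def)
  qed
  have c: "c j \<in> S'" if "j \<le> 3" for j
    by (rule nrc_frame_in_subspace[of _ 3 "T\<^sub>2 \<union> R\<^sub>2", OF S'(1) _ _ that])
      (use R\<^sub>2 cubic S' in \<open>auto simp: A_def\<close>)
  have "S' = UNIV"
    using S'(1) b c by (rule eq_UNIV_if_basis)
  then have "7 = vec.dim S'"
    by (simp add: card_cart_basis)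
  also have "\<dots> \<le> vec.dim S + card A"
    unfolding S'_def by (rule dim_span_Un_le_card) (simp add: A_def)
  also have "card A \<le> card R\<^sub>1 + card R\<^sub>2"
    unfolding A_def by (rule order.trans[OF card_Un_le]) (intro add_mono card_image_le; simp)
  finally show ?thesis
    using R\<^sub>1(1) R\<^sub>2(1) T\<^sub>1(1) T\<^sub>2(1) by simp
qed

end

section \<open>Twisted cubics on the scroll\<close>

lemma sum_atMost_2: "(\<Sum>j\<le>2. f j) = f 0 + f 1 + f (2::nat)"
  by (simp add: numeral_2_eq_2)

lemma sum_atMost_3: "(\<Sum>j\<le>3. f j) = f 0 + f 1 + f 2 + f (3::nat)"
  by (simp add: numeral_3_eq_3 numeral_2_eq_2)

context quintic_scroll
begin

text \<open>The difference of the two vectors is a multiple of the vector of the conic. Hence a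
  subspace that misses this point of the conic meets the generator at most once.\<close>

lemma vec_on_unique:
  assumes U: "vec.subspace U" and "nrc_vec 2 b \<theta> \<notin> U" "vec_on \<theta> x \<in> U" "vec_on \<theta> x' \<in> U"
  shows "x = x'"
proof (rule ccontr)
  assume "x \<noteq> x'"
  have "vec_on \<theta> x - vec_on \<theta> x' = (x - x') *s nrc_vec 2 b \<theta>"
    by (simp add: vec_on_def vec.scale_left_diff_distrib)
  then have "(x - x') *s nrc_vec 2 b \<theta> \<in> U"
    using assms vec.subspace_diff by metis
  then have "inverse (x - x') *s ((x - x') *s nrc_vec 2 b \<theta>) \<in> U"
    by (rule vec.subspace_scale[OF U])
  also have "inverse (x - x') *s ((x - x') *s nrc_vec 2 b \<theta>) = nrc_vec 2 b \<theta>"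
    using \<open>x \<noteq> x'\<close> by (simp only: vec.scale_scale) simp
  finally show False using assms(2) by simp
qed

lemma card_twisted_cubic:
  fixes d :: "nat \<Rightarrow> 'a ^ 'n"
  assumes "pg_frame 3 U d"
  shows "card (range (nrc_point 3 d)) = CARD('a) + 1"
  using nrc_point_inj[OF assms] q by (simp add: card_image)

text \<open>If the solid \<open>U\<close> of a twisted cubic on the surface met the conic, it would be met by too few
  generators outside the conic: each of them contributes at most two points, and at most one
  unless \<open>U\<close> contains its point on the conic.\<close>

lemma solid_misses_conic:
  assumes d: "pg_frame 3 U d" and N: "range (nrc_point 3 d) \<subseteq> surface"
  shows "nrc_vec 2 b \<theta> \<notin> U"
proof
  assume \<theta>: "nrc_vec 2 b \<theta> \<in> U"
  note U = pg_frame_subspace[OF d]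
  have dimU: "vec.dim U = 4" using pg_frame_dim[OF d] by simp
  let ?N = "range (nrc_point 3 d)"
  \<comment> \<open>The points of the cubic are split into those on the conic, \<open>M\<close>, and
    those on each generator off the conic, \<open>A \<theta>\<close>. The sets \<open>D\<close> and
    \<open>E\<close> hold the parameters at which these can occur.\<close>
  define D where "D = {\<theta>. nrc_vec 2 b \<theta> \<in> U}"
  define E where "E = {\<theta>. \<exists>x. vec_on \<theta> x \<in> U}"
  define A where "A \<theta> = {P \<in> ?N. \<exists>x. P = vec.span {vec_on \<theta> x}}" for \<theta>
  define M where "M = {P \<in> ?N. P \<in> nrc_point 2 b ` D}"
  have NU: "P \<subseteq> U" if "P \<in> ?N" for P
    using that nrc_point_subset[OF d] by blast
  have inU: "v \<in> U" if "vec.span {v} \<in> ?N" for v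
    using NU[OF that] vec.span_base[of v "{v}"] by auto
  have cover: "?N \<subseteq> M \<union> (\<Union>\<theta>\<in>E. A \<theta>)"
  proof
    fix P assume P: "P \<in> ?N"
    then obtain \<theta> where "P \<in> pg_points (generator \<theta>)"
      using N by (auto simp: surface_def)
    then show "P \<in> M \<union> (\<Union>\<theta>\<in>E. A \<theta>)"
    proof (cases rule: points_generator_cases)
      case 1
      with P inU have "\<theta> \<in> D" by (auto simp: D_def nrc_point_eq[of 2])
      with 1 P show ?thesis by (auto simp: M_def)
    next
      case (2 x)
      with P inU have "\<theta> \<in> E" unfolding E_def by blast
      with 2 P show ?thesis unfolding A_def by blast
    qed
  qed
  have A2: "card (A \<theta>) \<le> 2" for \<theta>
  proof -
    have dim: "vec.dim (generator \<theta>) \<le> 2"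
      unfolding generator_eq vec.dim_span
      by (rule order.trans[OF vec.dim_le_card']) (auto simp: card_insert_if)
    have sub: "vec.subspace (generator \<theta>)" by (simp add: generator_eq)
    have "card (A \<theta>) \<le> card {P \<in> ?N. P \<subseteq> generator \<theta>}"
      using span_vec_on_in_points by (intro card_mono) (auto simp: A_def pg_points_def)
    also have "\<dots> \<le> vec.dim (generator \<theta>)"
      using dim q by (intro nrc_Int_subspace_card_le[OF d sub]) auto
    finally show ?thesis using dim by simp
  qed
  have A1: "card (A \<theta>) \<le> 1" if "\<theta> \<notin> D" for \<theta>
  proof -
    have "P = Q" if PQ: "P \<in> A \<theta>" "Q \<in> A \<theta>" for P Q
    proof -
      obtain x y where xy: "P = vec.span {vec_on \<theta> x}" "Q = vec.span {vec_on \<theta> y}"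
        "P \<in> ?N" "Q \<in> ?N"
        using PQ unfolding A_def by blast
      then have "x = y"
        using inU \<open>\<theta> \<notin> D\<close> by (intro vec_on_unique[OF U]) (auto simp: D_def)
      with xy show ?thesis by simp
    qed
    then show ?thesis by (simp add: card_le_Suc0_iff_eq)
  qed
  \<comment> \<open>The plane of the conic contains at most three points of a twisted cubic.\<close>
  have "card {P \<in> ?N. P \<subseteq> vec.span (b ` {..2})} \<le> 3"
  proof -
    have dim: "vec.dim (vec.span (b ` {..2})) \<le> 3"
      unfolding vec.dim_span
      using vec.dim_le_card'[of "b ` {..2}"] card_image_le[of "{..2}" b] by simp
    have "card {P \<in> ?N. P \<subseteq> vec.span (b ` {..2})} \<le> vec.dim (vec.span (b ` {..2}))"
      using dim q by (intro nrc_Int_subspace_card_le[OF d]) auto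
    with dim show ?thesis by simp
  qed
  moreover have "M \<subseteq> {P \<in> ?N. P \<subseteq> vec.span (b ` {..2})}"
  proof -
    have "nrc_vec 2 b \<epsilon> \<in> vec.span (b ` {..2})" for \<epsilon>
      by (intro nrc_vec_in_subspace) (auto intro: vec.span_base)
    then have "nrc_point 2 b \<epsilon> \<subseteq> vec.span (b ` {..2})" for \<epsilon>
      unfolding nrc_point_eq by (intro vec.span_minimal) auto
    then show ?thesis by (auto simp: M_def)
  qed
  ultimately have M3: "card M \<le> 3"
    using card_mono[of "{P \<in> ?N. P \<subseteq> vec.span (b ` {..2})}" M] by simp
  have MD: "card M \<le> card D"
    by (rule surj_card_le[of D M "nrc_point 2 b"]) (auto simp: M_def)
  obtain T\<^sub>1 where T\<^sub>1: "T\<^sub>1 \<subseteq> D" "card T\<^sub>1 = min 3 (card D)"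
    using obtain_subset_with_card_n[of "min 3 (card D)" D] by auto
  have "D \<noteq> {}" using \<theta> by (auto simp: D_def)
  then have T\<^sub>1_pos: "card T\<^sub>1 \<ge> 1"
    using T\<^sub>1(2) by (simp add: Suc_le_eq card_gt_0_iff)
  \<comment> \<open>Otherwise five independent points of the scroll would lie in \<open>U\<close>,
    which has linear dimension 4.\<close>
  have E: "card E \<le> 4 - card T\<^sub>1"
  proof (rule ccontr)
    assume "\<not> ?thesis"
    then have "5 - card T\<^sub>1 \<le> card E" by linarith
    then obtain T\<^sub>2 where T\<^sub>2: "T\<^sub>2 \<subseteq> E" "card T\<^sub>2 = 5 - card T\<^sub>1"
      using obtain_subset_with_card_n by metis
    have "card T\<^sub>1 + card T\<^sub>2 \<le> vec.dim U"
      by (rule scroll_points_le_dim[OF U])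
        (use T\<^sub>1 T\<^sub>2 T\<^sub>1_pos in \<open>auto simp: D_def E_def\<close>)
    with T\<^sub>1 T\<^sub>2 dimU show False by simp
  qed
  have "CARD('a) + 1 \<le> card (M \<union> (\<Union>\<theta>\<in>E. A \<theta>))"
    unfolding card_twisted_cubic[OF d, symmetric] using cover by (intro card_mono) auto
  also have "\<dots> \<le> card M + card (\<Union>\<theta>\<in>E. A \<theta>)"
    by (rule card_Un_le)
  also have "card (\<Union>\<theta>\<in>E. A \<theta>) \<le> (\<Sum>\<theta>\<in>E. card (A \<theta>))"
    by (rule card_UN_le) simp
  finally have total: "7 \<le> card M + (\<Sum>\<theta>\<in>E. card (A \<theta>))"
    using q by simp
  \<comment> \<open>At least 7 points have to be accounted for. If \<open>card D \<ge> 3\<close>,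
    then \<open>card E \<le> 1\<close> and the count is at most 3 + 2. Otherwise it is at most
    \<open>card D + (4 - card D) + card D\<close>, that is
    \<open>4 + card D \<le> 6\<close>.\<close>
  show False
  proof (cases "card D \<ge> 3")
    case True
    have "(\<Sum>\<theta>\<in>E. card (A \<theta>)) \<le> (\<Sum>\<theta>\<in>E. 2)"
      using A2 by (intro sum_mono)
    with total M3 E T\<^sub>1 True show False by simp
  next
    case False
    have "(\<Sum>\<theta>\<in>E. card (A \<theta>)) \<le> (\<Sum>\<theta>\<in>E. 1 + (if \<theta> \<in> D then 1 else 0))"
      using A1 A2 by (intro sum_mono) (auto simp: numeral_2_eq_2)
    also have "\<dots> = card E + card (E \<inter> D)"
      unfolding sum.distrib by (simp add: sum.If_cases)
    also have "card (E \<inter> D) \<le> card D" by (intro card_mono) auto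
    finally show False
      using total MD E T\<^sub>1 False by simp
  qed
qed

text \<open>Projection along the plane of the conic maps \<open>U\<close> onto the solid of the
  cubic, so the conic coordinates on \<open>U\<close> are linear in the cubic ones. Along the curve
  they become polynomials \<open>f i\<close> of degree at most 3 with values
  \<open>x * t ^ i\<close>, and comparing them forces \<open>x\<close> to be a linear form.\<close>

lemma solid_graph:
  assumes U: "vec.subspace U" "vec.dim U = 4" and meets: "\<And>\<theta>. \<exists>x. vec_on \<theta> x \<in> U"
  obtains l m where "\<And>\<theta>. vec_on \<theta> (line_form l m \<theta>) \<in> U"
proof -
  define \<pi> where "\<pi> v = (\<Sum>j\<le>3. \<gamma> j v *s c j)" for v
  have \<pi>_hom: "module_hom (*s) (*s) \<pi>"
    by unfold_locales
      (simp_all add: \<pi>_def \<gamma>_linear vec.scale_left_distrib sum.distrib vec.scale_sum_right)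
  interpret \<pi>: module_hom "(*s)" "(*s)" \<pi> by (rule \<pi>_hom)
  have \<gamma>_\<pi>: "\<gamma> i (\<pi> v) = \<gamma> i v" if "i \<le> 3" for i v
  proof -
    have "\<gamma> i (\<pi> v) = (\<Sum>j\<le>3. if i = j then \<gamma> j v else 0)"
      unfolding \<pi>_def \<gamma>_linear using that by (intro sum.cong) (auto simp: \<gamma>_c)
    with that show ?thesis by simp
  qed
  \<comment> \<open>The image of \<open>U\<close> contains every point of the directing cubic and
    therefore its frame.\<close>
  have "c j \<in> \<pi> ` U" if "j \<le> 3" for j
  proof (rule nrc_frame_in_subspace[of _ 3 UNIV, OF _ _ _ that])
    show "vec.subspace (\<pi> ` U)" using U(1) by (rule \<pi>.subspace_image)
    show "nrc_vec 3 c \<theta> \<in> \<pi> ` U" for \<theta>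
    proof -
      obtain x where x: "vec_on \<theta> x \<in> U" using meets by blast
      have "nrc_vec 3 c \<theta> = \<pi> (vec_on \<theta> x)"
        by (subst expand) (simp add: \<pi>_def \<beta>_cubic \<gamma>_cubic \<gamma>_vec_on)
      with x show ?thesis by blast
    qed
  qed (use q in simp)
  then have "\<exists>v. j \<le> 3 \<longrightarrow> v \<in> U \<and> c j = \<pi> v" for j by blast
  then obtain d where d: "\<And>j. j \<le> 3 \<Longrightarrow> d j \<in> U" "\<And>j. j \<le> 3 \<Longrightarrow> c j = \<pi> (d j)"
    by metis
  have dual: "\<gamma> i (d j) = (if i = j then 1 else 0)" if "i \<le> 3" "j \<le> 3" for i j
    using \<gamma>_\<pi>[of i "d j"] \<gamma>_c[of i j] d(2)[of j] that by simp
  have frame: "pg_frame 3 (vec.span (d ` {..3})) d"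
    using \<gamma>_hom dual by (rule pg_frame_of_dual)
  have "vec.span (d ` {..3}) \<subseteq> U"
    using d(1) U(1) by (intro vec.span_minimal) auto
  then have span: "vec.span (d ` {..3}) = U"
    using pg_frame_dim[OF frame] U by (intro vec.subspace_dim_equal) auto
  define p where "p i j = \<beta> i (d j)" for i j
  have coords: "\<beta> i v = (\<Sum>j\<le>3. \<gamma> j v * p i j)" if "v \<in> U" for i v
  proof -
    have "v = (\<Sum>j\<le>3. \<gamma> j v *s d j)"
      using \<gamma>_hom dual that[folded span] by (rule span_frame_expand)
    then have "\<beta> i v = \<beta> i (\<Sum>j\<le>3. \<gamma> j v *s d j)" by simp
    then show ?thesis by (simp add: \<beta>_linear p_def)
  qed
  define f where "f i = [:p i 0, p i 1, p i 2, p i 3:]" for i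
  have eval: "poly (f i) t = x * t ^ i" if "vec_on (Some t) x \<in> U" "i \<le> 2" for i t x
  proof -
    have "x * t ^ i = (\<Sum>j\<le>3. \<gamma> j (vec_on (Some t) x) * p i j)"
      using coords[OF that(1), of i] that(2) by (simp add: \<beta>_vec_on)
    also have "\<dots> = (\<Sum>j\<le>3. t ^ j * p i j)"
      by (intro sum.cong) (auto simp: \<gamma>_vec_on)
    also have "\<dots> = poly (f i) t"
      unfolding sum_atMost_3 by (simp add: f_def algebra_simps power2_eq_square power3_eq_cube)
    finally show ?thesis ..
  qed
  have deg: "degree (f i) \<le> 3" for i
    by (simp add: f_def)
  have shift1: "f 1 = pCons 0 (f 0)"
  proof (rule poly_eqI_degree[of UNIV])
    fix t
    obtain x where "vec_on (Some t) x \<in> U" using meets by blast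
    from eval[OF this, of 0] eval[OF this, of 1] show "poly (f 1) t = poly (pCons 0 (f 0)) t"
      by simp
  qed (use deg[of 0] deg[of 1] degree_pCons_le[of 0 "f 0"] q in linarith)+
  \<comment> \<open>Both sides have degree at most 5 and agree at all field elements, of which there
    are at least 6.\<close>
  have shift2: "f 2 = pCons 0 (pCons 0 (f 0))"
  proof (rule poly_eqI_degree[of UNIV])
    fix t
    obtain x where "vec_on (Some t) x \<in> U" using meets by blast
    from eval[OF this, of 0] eval[OF this, of 2]
    show "poly (f 2) t = poly (pCons 0 (pCons 0 (f 0))) t"
      by (simp add: power2_eq_square)
  qed (use deg[of 0] deg[of 2] degree_pCons_le[of 0 "f 0"] degree_pCons_le[of 0 "pCons 0 (f 0)"] q
      in linarith)+
  \<comment> \<open>As \<open>f 2\<close> has no terms of degree 4 and 5, \<open>f 0\<close> has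
    degree at most 1. Comparing the coefficients of degree 3 identifies the coordinate
    \<open>p 2 3\<close> at infinity with the slope of \<open>f 0\<close>.\<close>
  have p: "p 0 2 = 0" "p 0 3 = 0" "p 2 3 = p 0 1"
    using shift1 shift2 by (simp_all add: f_def split: if_splits)
  have "vec_on \<theta> (line_form (p 0 0) (p 0 1) \<theta>) \<in> U" for \<theta>
  proof -
    obtain x where x: "vec_on \<theta> x \<in> U" using meets by blast
    have "x = line_form (p 0 0) (p 0 1) \<theta>"
    proof (cases \<theta>)
      case None
      have "x = (\<Sum>j\<le>3. \<gamma> j (vec_on \<theta> x) * p 2 j)"
        using coords[OF x, of 2] by (simp add: \<beta>_vec_on None)
      also have "\<dots> = p 2 3"
        by (simp add: sum_atMost_3 \<gamma>_vec_on None)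
      finally show ?thesis by (simp add: None line_form_def p)
    next
      case (Some t)
      then show ?thesis
        using eval[of t x 0] x by (simp add: f_def p line_form_def algebra_simps)
    qed
    with x show ?thesis by simp
  qed
  then show ?thesis by (rule that)
qed

section \<open>Linear forms classify the twisted cubics on the surface\<close>

definition cubic_of :: "'a \<Rightarrow> 'a \<Rightarrow> ('a ^ 7) set set" where
  "cubic_of l m = range (\<lambda>\<theta>. vec.span {vec_on \<theta> (line_form l m \<theta>)})"

lemma span_vec_on_in_cubic_of [simp]:
  "vec.span {vec_on \<theta> x} \<in> cubic_of l m \<longleftrightarrow> x = line_form l m \<theta>"
proof
  assume "vec.span {vec_on \<theta> x} \<in> cubic_of l m"
  then obtain \<theta>' where "vec.span {vec_on \<theta> x} = vec.span {vec_on \<theta>' (line_form l m \<theta>')}"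
    unfolding cubic_of_def by (rule rangeE)
  then show "x = line_form l m \<theta>" using span_vec_on_inj by blast
qed (simp add: cubic_of_def)

lemma cubic_of_is_twisted_cubic: "twisted_cubic (cubic_of l m)"
proof -
  \<comment> \<open>This is the coefficient of \<open>t ^ j\<close> after multiplying out
    \<open>(l + m * t)\<close> times the conic vector and adding the cubic vector; the conditions
    drop the missing terms at both ends.\<close>
  define d where "d j = c j + (if j \<le> 2 then l *s b j else 0) + (if j = 0 then 0 else m *s b (j - 1))"
    for j
  have "\<gamma> i (d j) = (if i = j then 1 else 0)" if "i \<le> 3" "j \<le> 3" for i j
    using that by (auto simp: d_def \<gamma>_linear \<gamma>_b \<gamma>_c)
  with \<gamma>_hom have frame: "pg_frame 3 (vec.span (d ` {..3})) d"
    by (rule pg_frame_of_dual)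
  have "nrc_vec 3 d \<theta> = vec_on \<theta> (line_form l m \<theta>)" for \<theta>
  proof (cases \<theta>)
    case None
    then show ?thesis by (simp add: d_def vec_on_def line_form_def)
  next
    case (Some t)
    have d_eq: "d 0 = c 0 + l *s b 0" "d 1 = c 1 + l *s b 1 + m *s b 0"
        "d 2 = c 2 + l *s b 2 + m *s b 1" "d 3 = c 3 + m *s b 2"
      by (simp_all add: d_def)
    show ?thesis
      unfolding Some nrc_vec_simps vec_on_def sum_atMost_2 sum_atMost_3 d_eq line_form_def
        option.case vec_eq_iff
      by (simp add: algebra_simps power2_eq_square power3_eq_cube)
  qed
  then have "cubic_of l m = range (nrc_point 3 d)"
    by (simp add: cubic_of_def nrc_point_eq)
  moreover have "pg_subspace 3 (vec.span (d ` {..3}))"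
    using pg_frame_dim[OF frame] by (simp add: pg_subspace_def)
  ultimately show ?thesis
    using frame unfolding twisted_cubic_def normal_rational_curve_def by blast
qed

lemma cubic_of_subset_surface: "cubic_of l m \<subseteq> surface"
  using span_vec_on_in_points by (auto simp: cubic_of_def surface_def)

text \<open>The solid of \<open>N\<close> misses the conic, so each generator carries at most one
  point of \<open>N\<close>. There are as many points as generators, so every generator meets
  \<open>N\<close> and \<open>solid_graph\<close> supplies the form. Equality follows from inclusion
  by comparing cardinalities.\<close>

lemma twisted_cubic_in_surface:
  assumes "twisted_cubic N" and N: "N \<subseteq> surface"
  obtains l m where "N = cubic_of l m"
proof -
  obtain U d where d: "pg_frame 3 U d" and N_eq: "N = range (nrc_point 3 d)"
    using assms(1) by (auto simp: twisted_cubic_def normal_rational_curve_def)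
  note U = pg_frame_subspace[OF d]
  have dimU: "vec.dim U = 4" using pg_frame_dim[OF d] by simp
  have miss: "nrc_vec 2 b \<theta> \<notin> U" for \<theta>
    using d N unfolding N_eq by (rule solid_misses_conic)
  have "P \<subseteq> U" if "P \<in> N" for P
    using that nrc_point_subset[OF d] by (auto simp: N_eq)
  then have inU: "v \<in> U" if "vec.span {v} \<in> N" for v
    using that vec.span_base[of v "{v}"] by blast
  have on: "\<exists>\<theta> x. P = vec.span {vec_on \<theta> x} \<and> vec_on \<theta> x \<in> U" if P: "P \<in> N" for P
  proof -
    obtain \<theta> where "P \<in> pg_points (generator \<theta>)"
      using N P by (auto simp: surface_def)
    then show ?thesis
    proof (cases rule: points_generator_cases)
      case 1
      with P inU miss show ?thesis by (auto simp: nrc_point_eq)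
    next
      case (2 x)
      with P inU show ?thesis by blast
    qed
  qed
  then obtain \<tau> \<xi> where \<tau>: "\<And>P. P \<in> N \<Longrightarrow> P = vec.span {vec_on (\<tau> P) (\<xi> P)}"
      "\<And>P. P \<in> N \<Longrightarrow> vec_on (\<tau> P) (\<xi> P) \<in> U"
    by metis
  have "inj_on \<tau> N"
  proof (rule inj_onI)
    fix P Q assume PQ: "P \<in> N" "Q \<in> N" "\<tau> P = \<tau> Q"
    then have "\<xi> P = \<xi> Q"
      using \<tau>(2)[of P] \<tau>(2)[of Q] miss U by (intro vec_on_unique) auto
    with PQ \<tau>(1)[of P] \<tau>(1)[of Q] show "P = Q" by simp
  qed
  then have "card (\<tau> ` N) = CARD('a option)"
    using card_twisted_cubic[OF d] by (simp add: card_image N_eq)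
  then have "\<tau> ` N = UNIV"
    by (intro card_subset_eq) auto
  then have meets: "\<exists>x. vec_on \<theta> x \<in> U" for \<theta>
    using \<tau>(2) by (metis UNIV_I imageE)
  obtain l m where lm: "\<And>\<theta>. vec_on \<theta> (line_form l m \<theta>) \<in> U"
    using solid_graph[OF U dimU meets] by blast
  have "N \<subseteq> cubic_of l m"
  proof
    fix P assume P: "P \<in> N"
    have "\<xi> P = line_form l m (\<tau> P)"
      using \<tau>(2)[OF P] lm miss U by (intro vec_on_unique) auto
    then have "vec.span {vec_on (\<tau> P) (\<xi> P)} \<in> cubic_of l m" by simp
    then show "P \<in> cubic_of l m" using \<tau>(1)[OF P] by simp
  qed
  moreover have "card (cubic_of l m) \<le> card N"
  proof -
    have "card (cubic_of l m) \<le> CARD('a option)"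
      unfolding cubic_of_def by (rule card_image_le) simp
    then show ?thesis using card_twisted_cubic[OF d] by (simp add: N_eq)
  qed
  moreover have "finite (cubic_of l m)" by (simp add: cubic_of_def)
  ultimately have "N = cubic_of l m"
    using card_seteq by blast
  then show ?thesis by (rule that)
qed

lemma twisted_cubics_meet_once:
  assumes "twisted_cubic M" "twisted_cubic N" "M \<subseteq> surface" "N \<subseteq> surface" "M \<noteq> N"
  shows "\<exists>!P. P \<in> M \<inter> N"
proof -
  obtain l m where M: "M = cubic_of l m"
    using assms twisted_cubic_in_surface by metis
  obtain l' m' where N: "N = cubic_of l' m'"
    using assms twisted_cubic_in_surface by metis
  obtain \<theta> where \<theta>: "line_form l m \<theta> = line_form l' m' \<theta>"
    using line_form_meet by blast
  show ?thesis
  proof (rule ex1I)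
    show "vec.span {vec_on \<theta> (line_form l m \<theta>)} \<in> M \<inter> N"
      using \<theta> by (simp add: M N)
    fix P assume P: "P \<in> M \<inter> N"
    then obtain \<theta>' where \<theta>': "P = vec.span {vec_on \<theta>' (line_form l m \<theta>')}"
      by (auto simp: M cubic_of_def)
    with P have "line_form l m \<theta>' = line_form l' m' \<theta>'" by (simp add: N)
    then have "\<theta>' = \<theta>"
      using \<theta> line_form_unique[of \<theta> \<theta>' l m l' m'] assms(5) M N by blast
    with \<theta>' show "P = vec.span {vec_on \<theta> (line_form l m \<theta>)}" by simp
  qed
qed

text \<open>Off the conic, each point prescribes the value of the linear form at the parameter of
  its generator, and two values determine the form.\<close>

lemma unique_twisted_cubic_through:
  assumes "\<theta> \<noteq> \<theta>'" "P \<in> pg_points (generator \<theta>)" "Q \<in> pg_points (generator \<theta>')"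
    and "P \<notin> range (nrc_point 2 b)" "Q \<notin> range (nrc_point 2 b)"
  shows "\<exists>!N. twisted_cubic N \<and> N \<subseteq> surface \<and> P \<in> N \<and> Q \<in> N"
proof -
  obtain x where P: "P = vec.span {vec_on \<theta> x}"
    using assms(2,4) by (auto elim: points_generator_cases)
  obtain y where Q: "Q = vec.span {vec_on \<theta>' y}"
    using assms(3,5) by (auto elim: points_generator_cases)
  obtain l m where lm: "line_form l m \<theta> = x" "line_form l m \<theta>' = y"
    using line_form_interpolate[OF assms(1)] by blast
  show ?thesis
  proof (rule ex1I)
    show "twisted_cubic (cubic_of l m) \<and> cubic_of l m \<subseteq> surface \<and> P \<in> cubic_of l m \<and> Q \<in> cubic_of l m"
      using lm by (simp add: P Q cubic_of_is_twisted_cubic cubic_of_subset_surface)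
    fix N assume N: "twisted_cubic N \<and> N \<subseteq> surface \<and> P \<in> N \<and> Q \<in> N"
    then obtain l' m' where N_eq: "N = cubic_of l' m'"
      using twisted_cubic_in_surface by metis
    with N have "line_form l m \<theta> = line_form l' m' \<theta>" "line_form l m \<theta>' = line_form l' m' \<theta>'"
      by (simp_all add: P Q lm)
    with assms(1) have "l = l' \<and> m = m'" by (rule line_form_unique)
    then show "N = cubic_of l m" by (simp add: N_eq)
  qed
qed

end

section \<open>Ruled quintic surfaces\<close>

text \<open>Without a common point the two subspaces meet only in 0, so their dimensions 3 and 4 add
  up to 7. The two frames together are then a basis, and the functionals are its
  coordinates.\<close>

lemma quintic_scroll_of_frames:
  fixes b c :: "nat \<Rightarrow> 'a::{field,finite} ^ 7"
  assumes q: "CARD('a) \<ge> 6" and b: "pg_frame 2 \<alpha> b" and c: "pg_frame 3 \<Sigma> c"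
    and disjoint: "pg_points \<alpha> \<inter> pg_points \<Sigma> = {}"
  obtains \<beta> \<gamma> where "quintic_scroll b c \<beta> \<gamma>"
proof -
  have \<alpha>: "vec.subspace \<alpha>" "vec.dim \<alpha> = 3" "vec.span (b ` {..2}) = \<alpha>" "inj_on b {..2}"
    using b pg_frame_subspace[OF b] pg_frame_dim[OF b] by (simp_all add: pg_frame_def)
  have \<Sigma>: "vec.subspace \<Sigma>" "vec.dim \<Sigma> = 4" "vec.span (c ` {..3}) = \<Sigma>" "inj_on c {..3}"
    using c pg_frame_subspace[OF c] pg_frame_dim[OF c] by (simp_all add: pg_frame_def)
  have "v = 0" if v: "v \<in> \<alpha>" "v \<in> \<Sigma>" for v
  proof (rule ccontr)
    assume "v \<noteq> 0"
    moreover have "vec.span {v} \<subseteq> \<alpha>" "vec.span {v} \<subseteq> \<Sigma>"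
      using v \<alpha>(1) \<Sigma>(1) by (intro vec.span_minimal; simp)+
    ultimately have "vec.span {v} \<in> pg_points \<alpha> \<inter> pg_points \<Sigma>"
      unfolding pg_points_def pg_subspace_0_iff by blast
    with disjoint show False by simp
  qed
  then have Int: "\<alpha> \<inter> \<Sigma> = {0}"
    using vec.subspace_0[OF \<alpha>(1)] vec.subspace_0[OF \<Sigma>(1)] by auto
  define B where "B = b ` {..2} \<union> c ` {..3}"
  have "vec.dim (vec.span B) = 7"
    using vec.dim_sums_Int[OF \<alpha>(1) \<Sigma>(1)]
    unfolding B_def vec.span_Un by (simp add: Int \<alpha> \<Sigma>)
  then have span: "vec.span B = UNIV"
    by (intro vec.subspace_dim_equal) (simp_all add: card_cart_basis)
  have fin: "finite B" by (simp add: B_def)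
  have "card B \<le> 7"
    unfolding B_def
    using card_Un_le[of "b ` {..2}" "c ` {..3}"] card_image_le[of "{..2}" b]
      card_image_le[of "{..3}" c] by simp
  then have indep: "vec.independent B"
    using span fin by (intro vec.card_le_dim_spanning[of B UNIV]) (auto simp: card_cart_basis)
  have mem: "i \<le> 2 \<Longrightarrow> b i \<in> B" "j \<le> 3 \<Longrightarrow> c j \<in> B" for i j
    by (auto simp: B_def)
  have ne: "b i \<noteq> c j" if "i \<le> 2" "j \<le> 3" for i j
  proof
    assume "b i = c j"
    moreover have "b i \<in> \<alpha>" "c j \<in> \<Sigma>"
      using that by (auto simp: \<alpha>(3)[symmetric] \<Sigma>(3)[symmetric] intro: vec.span_base)
    ultimately have "b i = 0" using Int by auto
    with mem(1)[OF that(1)] indep show False using vec.dependent_zero by metis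
  qed
  define \<beta> where "\<beta> i v = vec.representation B v (b i)" for i v
  define \<gamma> where "\<gamma> i v = vec.representation B v (c i)" for i v
  have hom: "module_hom (*s) (*) (\<lambda>v. vec.representation B v x)" for x
    by unfold_locales
      (simp_all add: span indep vec.representation_add vec.representation_scale algebra_simps)
  note rep = vec.representation_basis[OF indep]
  have "quintic_scroll b c \<beta> \<gamma>"
  proof
    show "6 \<le> CARD('a)" by (rule q)
    show "\<beta> i (b j) = (if i = j then 1 else 0)" if "i \<le> 2" "j \<le> 2" for i j
      using that inj_onD[OF \<alpha>(4), of i j] by (auto simp: \<beta>_def rep mem)
    show "\<beta> i (c j) = 0" if "i \<le> 2" "j \<le> 3" for i j
      using that ne by (auto simp: \<beta>_def rep mem)
    show "\<gamma> i (b j) = 0" if "i \<le> 3" "j \<le> 2" for i j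
      using that ne[OF that(2,1)] by (auto simp: \<gamma>_def rep mem)
    show "\<gamma> i (c j) = (if i = j then 1 else 0)" if "i \<le> 3" "j \<le> 3" for i j
      using that inj_onD[OF \<Sigma>(4), of i j] by (auto simp: \<gamma>_def rep mem)
    show "v = (\<Sum>i\<le>2. \<beta> i v *s b i) + (\<Sum>j\<le>3. \<gamma> j v *s c j)" for v
    proof -
      have "v = (\<Sum>x\<in>B. vec.representation B v x *s x)"
        using vec.sum_representation_eq[OF indep _ fin, of v] span by simp
      also have "\<dots> = (\<Sum>x\<in>b ` {..2}. vec.representation B v x *s x)
          + (\<Sum>x\<in>c ` {..3}. vec.representation B v x *s x)"
        unfolding B_def using ne by (intro sum.union_disjoint) auto
      finally show ?thesis
        by (simp add: sum.reindex[OF \<alpha>(4)] sum.reindex[OF \<Sigma>(4)] \<beta>_def \<gamma>_def)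
    qed
  qed (simp_all add: \<beta>_def \<gamma>_def module_hom.add[OF hom] module_hom.scale[OF hom])
  then show ?thesis by (rule that)
qed

theorem theorem3p5:
  fixes V C G :: "('a::{field,finite} ^ 7) set set" and q :: nat
  assumes "CARD('a) = q" and "q \<ge> 6"
    and "ruled_quintic_surface V C G"
  shows "(\<forall>M N. twisted_cubic M \<and> twisted_cubic N \<and> M \<subseteq> V \<and> N \<subseteq> V \<and> M \<noteq> N
             \<longrightarrow> (\<exists>!P. P \<in> M \<inter> N)) \<and>
         (\<forall>P Q. P \<in> V \<and> Q \<in> V \<and>
             (\<exists>g\<in>G. \<exists>h\<in>G. g \<noteq> h \<and> P \<in> pg_points g \<and> Q \<in> pg_points h) \<and>
             P \<notin> C \<and> Q \<notin> C
             \<longrightarrow> (\<exists>!N. twisted_cubic N \<and> N \<subseteq> V \<and> P \<in> N \<and> Q \<in> N))"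
proof -
  have q: "CARD('a) \<ge> 6" using assms(1,2) by simp
  obtain \<alpha> \<Sigma> b c \<phi> where disjoint: "pg_points \<alpha> \<inter> pg_points \<Sigma> = {}"
    and b: "pg_frame 2 \<alpha> b" and c: "pg_frame 3 \<Sigma> c" and \<phi>: "\<phi> \<in> PGL2"
    and C: "C = range (nrc_point 2 b)"
    and G: "G = range (\<lambda>\<theta>. pg_join (nrc_point 2 b \<theta>) (nrc_point 3 c (\<phi> \<theta>)))"
    and V: "V = (\<Union>g\<in>G. pg_points g)"
    using assms(3) unfolding ruled_quintic_surface_def by blast
  \<comment> \<open>With the new frame of the same solid, generators join points with equal
    parameters, as the locale expects.\<close>
  obtain c' where c': "pg_frame 3 \<Sigma> c'" "\<And>\<theta>. nrc_point 3 c' \<theta> = nrc_point 3 c (\<phi> \<theta>)"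
    using nrc_reparametrise[OF \<phi> c] q by auto
  obtain \<beta> \<gamma> where "quintic_scroll b c' \<beta> \<gamma>"
    using quintic_scroll_of_frames[OF q b c'(1) disjoint] .
  then interpret quintic_scroll b c' \<beta> \<gamma> .
  have G_eq: "G = range generator"
    by (simp add: G generator_def c'(2))
  have V_eq: "V = surface"
    by (simp add: V G_eq surface_def)
  show ?thesis
    unfolding V_eq
  proof (intro conjI allI impI, goal_cases)
    case (1 M N)
    then show ?case by (intro twisted_cubics_meet_once) auto
  next
    case (2 P Q)
    then obtain \<theta> \<theta>' where "generator \<theta> \<noteq> generator \<theta>'"
        and PQ: "P \<in> pg_points (generator \<theta>)" "Q \<in> pg_points (generator \<theta>')"
      unfolding G_eq by blast
    then have "\<theta> \<noteq> \<theta>'" by blast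
    then show ?case
      using PQ by (rule unique_twisted_cubic_through) (use 2 C in simp_all)
  qed
qed

end
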